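(* Consider a stiffly accurate (S)DIRK method with non-negative coefficients $a_{i,j}\ge 0$ and weights $b_j=a_{s,j}\ge 0$, applied with step size $h>0$ from $\mathbf{y}_n\succeq 0$ to the graph Laplacian system $\mathbf{y}'=\mathbf{G}(\mathbf{y})\,\mathbf{y}$ with correction of every stage, as follows. For $i=1,\dots,s$, given the previously corrected stages $\mathbf{Y}_1,\dots,\mathbf{Y}_{i-1}$, let the predicted stage $\mathbf{Y}^{\{p\}}_i$ (possibly with negative entries) satisfy $$\mathbf{Y}^{\{p\}}_i=\mathbf{y}_n+h\sum_{j=1}^{i-1}a_{i,j}\,\mathbf{G}(\mathbf{Y}_j)\,\mathbf{Y}_j+h\,a_{i,i}\,\mathbf{G}(\mathbf{Y}^{\{p\}}_i)\,\mathbf{Y}^{\{p\}}_i,$$ and let the corrected stage $\mathbf{Y}_i$ be defined by $$\mathbf{Y}_i=\mathbf{y}_n+h\,\overline{\mathbf{G}}_i\,\mathbf{Y}_i,\qquad \overline{\mathbf{G}}_i=\sum_{j=1}^{i-1}a_{i,j}\,\mathbf{G}(\mathbf{Y}_j)\,\boldsymbol{\Sigma}_{\mathbf{Y}_j/\breve{\mathbf{Y}}^{\{p\}}_i}+a_{i,i}\,\mathbf{G}(\breve{\mathbf{Y}}^{\{p\}}_i).$$ The new solution is $\mathbf{y}_{n+1}=\mathbf{Y}_s$. Then, for each $i=1,\dots,s$, $\overline{\mathbf{G}}_i$ is a graph Laplacian matrix, and the corrected stage $\mathbf{Y}_i$ is non-negative, $\mathbf{Y}_i\succeq\mathbf{0}$,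 and conservative, $\mathbf{w}_k^T\mathbf{Y}_i=\mathbf{w}_k^T\mathbf{y}_n$ for $k=1,\dots,M$.
   Context: Notation: $\succeq 0$ means that all components are $\ge 0$; $\boldsymbol{1}_d\in\mathbb{R}^d$ is the vector of ones. System: $\mathbf{y}'=\mathbf{G}(t,\mathbf{y})\,\mathbf{y}$ in $\mathbb{R}^d$ with $\mathbf{G}(t,\mathbf{y})\in\mathbb{R}^{d\times d}$; in the numerical formulas the argument $t$ is suppressed. Standing assumptions on $\mathbf{G}$: (i) the eigenvalues of $\mathbf{G}(t,\mathbf{y})$ have non-positive real parts for all $t,\mathbf{y}$; (ii) $\mathbf{G}_{i,i}(t,\mathbf{y})\le 0$ for all $i$ and $\mathbf{G}_{i,j}(t,\mathbf{y})\ge 0$ for all $i\ne j$, for all $t\ge t_0$ and all $\mathbf{y}\succeq 0$; (iii) there are vectors $\mathbf{w}_1,\dots,\mathbf{w}_M\in\mathbb{R}^d$, $M<d$, with $\mathbf{w}_k^T\mathbf{G}(t,\mathbf{y})=\mathbf{0}$ for all $t,\mathbf{y}$, where $\mathbf{w}_1=\boldsymbol{1}_d$. A matrix is called a graph Laplacian matrix if its diagonal entries are non-positive, its off-diagonal entries are non-negative, and each of its columns sums to zero. (S)DIRK method: $s$-stage (singly) diagonally implicit Runge-Kutta method with coefficients $a_{i,j}$ ($j\le i$) and weights $b_j$; stiffly accurate means $b_j=a_{s,j}$ for all $j$. Clipping: $\breve{\mathbf{Y}}=\mathrm{clip}(\mathbf{Y})$ has components $\breve{\mathbf{Y}}_\ell=\max(\mathbf{Y}_\ell,0)$,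 $\ell=1,\dots,d$. Ratio scaling: for $\mathbf{Y},\mathbf{Z}\in\mathbb{R}^d$ and a fixed threshold $\varepsilon>0$, $\boldsymbol{\Sigma}_{\mathbf{Y}/\mathbf{Z}}=\mathrm{diag}_{\ell=1,\dots,d}\ \dfrac{\max(\mathbf{Y}_\ell,0)}{\max(\mathbf{Z}_\ell,\varepsilon)}\in\mathbb{R}^{d\times d}$. *)

theory Defs
  imports "HOL-Analysis.Analysis"
begin

definition is_eigenvalue :: "real^'d^'d \<Rightarrow> complex \<Rightarrow> bool" where
  "is_eigenvalue A \<mu> \<longleftrightarrow> (\<exists>v. v \<noteq> 0 \<and> map_matrix complex_of_real A *v v = \<mu> *s v)"

definition graph_laplacian :: "real^'d^'d \<Rightarrow> bool" where
  "graph_laplacian A \<longleftrightarrow>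
     (\<forall>l. A $ l $ l \<le> 0) \<and> (\<forall>l m. l \<noteq> m \<longrightarrow> 0 \<le> A $ l $ m) \<and> (\<forall>m. (\<Sum>l\<in>UNIV. A $ l $ m) = 0)"

definition clip :: "real^'d \<Rightarrow> real^'d" where
  "clip Y = (\<chi> l. max (Y $ l) 0)"

definition ratio_scaling :: "real \<Rightarrow> real^'d \<Rightarrow> real^'d \<Rightarrow> real^'d^'d" where
  "ratio_scaling \<epsilon> Y Z = (\<chi> l m. if l = m then max (Y $ l) 0 / max (Z $ l) \<epsilon> else 0)"

text \<open>Stages are indexed from 1. The argument \<open>\<tau> i\<close> is the time at which
  the matrix is evaluated in stage \<open>i\<close>; an autonomous system is the case of a matrix
  that is constant in its first argument.\<close>

definition predicted_stage_eq ::
  "(real \<Rightarrow> real^'d \<Rightarrow> real^'d^'d) \<Rightarrow> (nat \<Rightarrow> real) \<Rightarrow> (nat \<Rightarrow> nat \<Rightarrow> real) \<Rightarrow> real \<Rightarrow> real^'d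
    \<Rightarrow> (nat \<Rightarrow> real^'d) \<Rightarrow> (nat \<Rightarrow> real^'d) \<Rightarrow> nat \<Rightarrow> bool" where
  "predicted_stage_eq G \<tau> a h yn Y Yp i \<longleftrightarrow>
     Yp i = yn + h *\<^sub>R (\<Sum>j\<in>{1..<i}. a i j *\<^sub>R (G (\<tau> j) (Y j) *v Y j))
               + (h * a i i) *\<^sub>R (G (\<tau> i) (Yp i) *v Yp i)"

definition corrected_matrix ::
  "(real \<Rightarrow> real^'d \<Rightarrow> real^'d^'d) \<Rightarrow> (nat \<Rightarrow> real) \<Rightarrow> (nat \<Rightarrow> nat \<Rightarrow> real) \<Rightarrow> real
    \<Rightarrow> (nat \<Rightarrow> real^'d) \<Rightarrow> (nat \<Rightarrow> real^'d) \<Rightarrow> nat \<Rightarrow> real^'d^'d" where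
  "corrected_matrix G \<tau> a \<epsilon> Y Yp i =
     (\<Sum>j\<in>{1..<i}. a i j *\<^sub>R (G (\<tau> j) (Y j) ** ratio_scaling \<epsilon> (Y j) (clip (Yp i))))
       + a i i *\<^sub>R G (\<tau> i) (clip (Yp i))"

definition corrected_stage_eq ::
  "(real \<Rightarrow> real^'d \<Rightarrow> real^'d^'d) \<Rightarrow> (nat \<Rightarrow> real) \<Rightarrow> (nat \<Rightarrow> nat \<Rightarrow> real) \<Rightarrow> real \<Rightarrow> real \<Rightarrow> real^'d
    \<Rightarrow> (nat \<Rightarrow> real^'d) \<Rightarrow> (nat \<Rightarrow> real^'d) \<Rightarrow> nat \<Rightarrow> bool" where
  "corrected_stage_eq G \<tau> a \<epsilon> h yn Y Yp i \<longleftrightarrow>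
     Y i = yn + h *\<^sub>R (corrected_matrix G \<tau> a \<epsilon> Y Yp i *v Y i)"

end

(* The corrected matrix is a non-negative combination of Laplacians times non-negative
   diagonal matrices, hence a Laplacian annihilated from the left by the same vectors. In an
   implicit Euler step with a Laplacian, summing the equation over the negative components of
   the solution gives a non-negative right-hand side because columns sum to zero, so there are
   no negative components. *)
theory Submission
  imports Defs
begin

text \<open>Zero column sums are recast as annihilation from the left by the vector of ones, the
  form in which the hypothesis on \<open>w 1\<close> supplies them.\<close>

lemma graph_laplacian_iff_ones:
  fixes A :: "real^'d^'d"
  shows "graph_laplacian A \<longleftrightarrow>
    (\<forall>l. A $ l $ l \<le> 0) \<and> (\<forall>l m. l \<noteq> m \<longrightarrow> 0 \<le> A $ l $ m) \<and> (\<chi> l. 1) v* A = 0"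
  by (simp add: graph_laplacian_def vector_matrix_mult_def vec_eq_iff)

lemma matrix_mult_ratio_scaling_nth:
  "(A ** ratio_scaling \<epsilon> Y Z) $ l $ m = A $ l $ m * (max (Y $ m) 0 / max (Z $ m) \<epsilon>)"
  by (simp add: matrix_matrix_mult_def ratio_scaling_def if_distrib cong: if_cong)

lemma ratio_scaling_nonneg: "0 < \<epsilon> \<Longrightarrow> 0 \<le> max (x::real) 0 / max z \<epsilon>"
  by (simp add: divide_nonneg_pos max.strict_coboundedI2)

text \<open>A diagonal factor on the right multiplies each column by a single number, here
  non-negative because the threshold keeps the denominator positive. Signs are kept, and the number
  factors out of the column sum.\<close>

lemma graph_laplacian_mult_ratio_scaling:
  fixes A :: "real^'d^'d"
  assumes "graph_laplacian A" "0 < \<epsilon>"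
  shows "graph_laplacian (A ** ratio_scaling \<epsilon> Y Z)"
  unfolding graph_laplacian_def matrix_mult_ratio_scaling_nth sum_distrib_right[symmetric]
  using assms(1) ratio_scaling_nonneg[OF assms(2)] unfolding graph_laplacian_def
  by (auto intro!: mult_nonpos_nonneg mult_nonneg_nonneg simp del: times_divide_eq_right)

lemma graph_laplacian_0: "graph_laplacian 0"
  by (simp add: graph_laplacian_def)

lemma graph_laplacian_add:
  "graph_laplacian A \<Longrightarrow> graph_laplacian B \<Longrightarrow> graph_laplacian (A + B)"
  by (auto simp: graph_laplacian_def sum.distrib intro: add_nonpos_nonpos)

lemma graph_laplacian_scaleR:
  "graph_laplacian A \<Longrightarrow> 0 \<le> r \<Longrightarrow> graph_laplacian (r *\<^sub>R A)"
  by (auto simp: graph_laplacian_def mult_nonneg_nonpos simp flip: sum_distrib_left)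

lemma graph_laplacian_sum:
  "(\<And>j. j \<in> J \<Longrightarrow> graph_laplacian (f j)) \<Longrightarrow> graph_laplacian (\<Sum>j\<in>J. f j)"
  by (induction J rule: infinite_finite_induct)
    (auto simp: graph_laplacian_0 intro: graph_laplacian_add)

lemma graph_laplacian_implicit_step_nonneg:
  fixes A :: "real^'d^'d"
  assumes A: "graph_laplacian A" and h: "0 \<le> h" and y0: "0 \<le> y0"
    and y: "y = y0 + h *\<^sub>R (A *v y)"
  shows "0 \<le> y"
proof -
  define N where "N = {l. y $ l < 0}"
  have y_nth: "y $ l = y0 $ l + h * (\<Sum>m\<in>UNIV. A $ l $ m * y $ m)" for l
    by (subst y) (simp add: matrix_vector_mult_def)
  \<comment> \<open>Both factors have matching signs. If \<open>m\<close> is in \<open>N\<close>,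
    the entries of column \<open>m\<close> in rows outside \<open>N\<close> are off-diagonal, so the
    rows in \<open>N\<close> carry the non-positive rest of a zero sum. If not, all rows in
    \<open>N\<close> are off-diagonal and \<open>y $ m\<close> is non-negative.\<close>
  have column: "0 \<le> (\<Sum>l\<in>N. A $ l $ m) * y $ m" for m
  proof (cases "m \<in> N")
    case True
    have "(\<Sum>l\<in>N. A $ l $ m) + (\<Sum>l\<in>-N. A $ l $ m) = (\<Sum>l\<in>UNIV. A $ l $ m)"
      by (subst sum.union_disjoint[symmetric]) auto
    moreover have "0 \<le> (\<Sum>l\<in>-N. A $ l $ m)"
      using A True by (intro sum_nonneg) (metis ComplD graph_laplacian_def)
    ultimately have "(\<Sum>l\<in>N. A $ l $ m) \<le> 0"
      using A by (simp add: graph_laplacian_def)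
    then show ?thesis
      using True by (simp add: N_def mult_nonpos_nonpos)
  next
    case False
    have "0 \<le> (\<Sum>l\<in>N. A $ l $ m)"
      using A False by (intro sum_nonneg) (metis graph_laplacian_def)
    then show ?thesis
      using False by (simp add: N_def)
  qed
  have "(\<Sum>l\<in>N. y $ l) = (\<Sum>l\<in>N. y0 $ l + h * (\<Sum>m\<in>UNIV. A $ l $ m * y $ m))"
    by (intro sum.cong refl y_nth)
  also have "\<dots> = (\<Sum>l\<in>N. y0 $ l) + h * (\<Sum>l\<in>N. \<Sum>m\<in>UNIV. A $ l $ m * y $ m)"
    by (simp add: sum.distrib sum_distrib_left)
  \<comment> \<open>Grouping by columns makes every summand non-negative by
    \<open>column\<close>.\<close>
  also have "(\<Sum>l\<in>N. \<Sum>m\<in>UNIV. A $ l $ m * y $ m) = (\<Sum>m\<in>UNIV. (\<Sum>l\<in>N. A $ l $ m) * y $ m)"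
    by (subst sum.swap) (simp add: sum_distrib_right)
  finally have sum_N: "0 \<le> (\<Sum>l\<in>N. y $ l)"
    using column h y0 by (simp add: sum_nonneg less_eq_vec_def)
  have "N = {}"
  proof (rule ccontr)
    assume "N \<noteq> {}"
    then have "(\<Sum>l\<in>N. y $ l) < (\<Sum>l\<in>N. 0)"
      by (intro sum_strict_mono finite) (auto simp: N_def)
    with sum_N show False by simp
  qed
  then show ?thesis
    by (auto simp: N_def less_eq_vec_def not_less)
qed

text \<open>In each term \<open>G\<close> is the leftmost matrix factor, so \<open>w\<close> meets
  it before the scaling.\<close>

lemma vector_matrix_mult_corrected_matrix:
  assumes "\<And>t y. w v* G t y = 0"
  shows "w v* corrected_matrix G \<tau> a \<epsilon> Y Yp i = 0"
proof -
  \<comment> \<open>The index range is freed to an arbitrary finite \<open>J\<close> so that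
    induction leaves the stage \<open>i\<close> fixed.\<close>
  have "w v* (\<Sum>j\<in>J. a i j *\<^sub>R (G (\<tau> j) (Y j) ** ratio_scaling \<epsilon> (Y j) (clip (Yp i)))) = 0"
    if "finite J" for J
    using that by (induction J)
      (simp_all add: vector_matrix_mult_add_rdistrib vector_scaleR_matrix_ac assms
        flip: vector_matrix_mul_assoc)
  then show ?thesis
    by (simp add: corrected_matrix_def vector_matrix_mult_add_rdistrib
        vector_scaleR_matrix_ac assms)
qed

text \<open>The sign pattern of \<open>G\<close> is available only at non-negative arguments:
  earlier stages meet this by assumption, the predicted stage because it is clipped.\<close>

lemma graph_laplacian_corrected_matrix:
  assumes lap: "\<And>j y. j \<in> {1..i} \<Longrightarrow> 0 \<le> y \<Longrightarrow> graph_laplacian (G (\<tau> j) y)"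
    and a: "\<And>j. j \<in> {1..i} \<Longrightarrow> 0 \<le> a i j"
    and Y: "\<And>j. j \<in> {1..<i} \<Longrightarrow> 0 \<le> Y j" and "1 \<le> i" "0 < \<epsilon>"
  shows "graph_laplacian (corrected_matrix G \<tau> a \<epsilon> Y Yp i)"
proof -
  have "0 \<le> clip (Yp i)"
    by (simp add: clip_def less_eq_vec_def)
  then show ?thesis
    unfolding corrected_matrix_def using assms
    by (intro graph_laplacian_add graph_laplacian_sum graph_laplacian_scaleR
        graph_laplacian_mult_ratio_scaling) auto
qed

theorem mainTheorem3:
  fixes G :: "real \<Rightarrow> real^'d \<Rightarrow> real^'d^'d"
    and w :: "nat \<Rightarrow> real^'d" and M s :: nat
    and a :: "nat \<Rightarrow> nat \<Rightarrow> real" and b c \<tau> :: "nat \<Rightarrow> real"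
    and t0 tn h \<epsilon> :: real
    and yn ynext :: "real^'d" and Y Yp :: "nat \<Rightarrow> real^'d"
  assumes eigenvalues: "\<And>t y \<mu>. is_eigenvalue (G t y) \<mu> \<Longrightarrow> Re \<mu> \<le> 0"
    and diagonal: "\<And>t y l. t0 \<le> t \<Longrightarrow> 0 \<le> y \<Longrightarrow> G t y $ l $ l \<le> 0"
    and off_diagonal: "\<And>t y l m. t0 \<le> t \<Longrightarrow> 0 \<le> y \<Longrightarrow> l \<noteq> m \<Longrightarrow> 0 \<le> G t y $ l $ m"
    and M: "1 \<le> M" "M < CARD('d)"
    and w_first: "w 1 = (\<chi> l. 1)"
    and w_null: "\<And>t y k. k \<in> {1..M} \<Longrightarrow> w k v* G t y = 0"
    and stages: "1 \<le> s"
    and a_nonneg: "\<And>i j. 1 \<le> j \<Longrightarrow> j \<le> i \<Longrightarrow> i \<le> s \<Longrightarrow> 0 \<le> a i j"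
    and stiffly_accurate: "\<And>j. j \<in> {1..s} \<Longrightarrow> b j = a s j"
    and b_nonneg: "\<And>j. j \<in> {1..s} \<Longrightarrow> 0 \<le> b j"
    and step: "0 < h" and threshold: "0 < \<epsilon>"
    and stage_times: "\<And>i. i \<in> {1..s} \<Longrightarrow> \<tau> i = tn + c i * h"
      "\<And>i. i \<in> {1..s} \<Longrightarrow> t0 \<le> \<tau> i"
    and yn_nonneg: "0 \<le> yn"
    and predicted: "\<And>i. i \<in> {1..s} \<Longrightarrow> predicted_stage_eq G \<tau> a h yn Y Yp i"
    and corrected: "\<And>i. i \<in> {1..s} \<Longrightarrow> corrected_stage_eq G \<tau> a \<epsilon> h yn Y Yp i"
    and new_solution: "ynext = Y s"
  shows "\<forall>i\<in>{1..s}. graph_laplacian (corrected_matrix G \<tau> a \<epsilon> Y Yp i)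
           \<and> 0 \<le> Y i
           \<and> (\<forall>k\<in>{1..M}. w k \<bullet> Y i = w k \<bullet> yn)"
proof -
  \<comment> \<open>Since \<open>1 \<le> M\<close>, the vector of ones \<open>w 1\<close> is among
    the annihilating vectors.\<close>
  have lap: "graph_laplacian (G (\<tau> i) y)" if "i \<in> {1..s}" "0 \<le> y" for i y
    using diagonal off_diagonal w_null[of 1] stage_times(2) that M(1)
    by (simp add: graph_laplacian_iff_ones flip: w_first)
  \<comment> \<open>Both claims go through one strong induction: the matrix of stage
    \<open>i\<close> evaluates \<open>G\<close> at all earlier corrected stages, whose
    non-negativity comes from their own matrices.\<close>
  have main: "graph_laplacian (corrected_matrix G \<tau> a \<epsilon> Y Yp i) \<and> 0 \<le> Y i" if "i \<in> {1..s}" for i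
    using that
  proof (induction i rule: less_induct)
    case (less i)
    have "graph_laplacian (corrected_matrix G \<tau> a \<epsilon> Y Yp i)"
      using less lap a_nonneg threshold by (intro graph_laplacian_corrected_matrix) auto
    moreover from this have "0 \<le> Y i"
      \<comment> \<open>The corrected matrix depends on \<open>Y\<close> only through earlier
        stages, so this is a linear implicit Euler step for \<open>Y i\<close>.\<close>
      using less_imp_le[OF step] yn_nonneg corrected[OF less.prems, unfolded corrected_stage_eq_def]
      by (rule graph_laplacian_implicit_step_nonneg)
    ultimately show ?case ..
  qed
  have "w k \<bullet> Y i = w k \<bullet> yn" if "i \<in> {1..s}" "k \<in> {1..M}" for i k
  proof -
    let ?A = "corrected_matrix G \<tau> a \<epsilon> Y Yp i"
    have "w k \<bullet> Y i = w k \<bullet> yn + h * (w k \<bullet> (?A *v Y i))"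
      using arg_cong[OF corrected[OF that(1), unfolded corrected_stage_eq_def], of "inner (w k)"]
      by (simp only: inner_add_right inner_scaleR_right)
    also have "w k \<bullet> (?A *v Y i) = (w k v* ?A) \<bullet> Y i"
      by (rule dot_lmul_matrix[symmetric])
    also have "w k v* ?A = 0"
      using w_null[OF that(2)] by (rule vector_matrix_mult_corrected_matrix)
    finally show ?thesis by simp
  qed
  with main show ?thesis by blast
qed

end
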